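(* Let $k\ge 1$ and let $A_i,B_{i1},\ldots,B_{ik}\in\mathbb{C}^{m_i\times n_i}$ with $m_i\ge n_i$ for $1\le i\le k$. Define $$\theta_1:=\inf \sum_{i=1}^k\big\|\big[\widehat A_i-A_i,\ \widehat B_{i1}-B_{i1},\ \ldots,\ \widehat B_{ik}-B_{ik}\big]\big\|_{F}^2,$$ where the infimum is over all matrices $\widehat A_i,\widehat B_{is}\in\mathbb{C}^{m_i\times n_i}$ ($1\le i,s\le k$), all scalars $\lambda_1,\ldots,\lambda_k\in\mathbb{C}$ and all vectors $\mathbf{x}_i\in\mathbb{C}^{n_i}$ with $\|\mathbf{x}_i\|_2=1$ ($1\le i\le k$) such that $$\widehat A_i\mathbf{x}_i=\sum_{s=1}^k\lambda_s\widehat B_{is}\mathbf{x}_i\quad\text{for } 1\le i\le k.$$ Then $$\theta_1=\min\ \sum_{i=1}^k\Big\|\gamma A_i\mathbf{x}_i-\sum_{s=1}^k\alpha_sB_{is}\mathbf{x}_i\Big\|_2^2,$$ where the minimum (which is attained) is over all real $\gamma\ge 0$, all $\alpha_1,\ldots,\alpha_k\in\mathbb{C}$ with $|\gamma|^2+\sum_{s=1}^k|\alpha_s|^2=1$, and all $\mathbf{x}_i\in\mathbb{C}^{n_i}$ with $\|\mathbf{x}_i\|_2=1$ for $1\le i\le k$.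
   Context: $\|\cdot\|_F$ is the Frobenius norm, $\|\cdot\|_2$ the Euclidean vector norm, and $[M_0,M_1,\ldots,M_k]$ denotes horizontal concatenation of matrices with the same number of rows. *)

theory Defs
  imports "Jordan_Normal_Form.Matrix" "HOL-Analysis.L2_Norm"
begin

definition eucl_norm :: "complex vec \<Rightarrow> real" where
  "eucl_norm v = L2_set (\<lambda>j. cmod (v $ j)) {..<dim_vec v}"

definition frob_norm :: "complex mat \<Rightarrow> real" where
  "frob_norm M = L2_set (\<lambda>(i, j). cmod (M $$ (i, j))) ({..<dim_row M} \<times> {..<dim_col M})"

(* The number of rows r is a parameter so that the empty list also yields a matrix with r rows;
   every matrix in the list is meant to have exactly r rows. *)
definition hconcat :: "nat \<Rightarrow> complex mat list \<Rightarrow> complex mat" where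
  "hconcat r Ms = mat_of_cols r (concat (map cols Ms))"

(* Families are indexed by 1, ..., k; their values at other indices are irrelevant, here and in the
   definitions below. *)
definition unit_family :: "nat \<Rightarrow> (nat \<Rightarrow> nat) \<Rightarrow> (nat \<Rightarrow> complex vec) \<Rightarrow> bool" where
  "unit_family k n x \<longleftrightarrow> (\<forall>i\<in>{1..k}. x i \<in> carrier_vec (n i) \<and> eucl_norm (x i) = 1)"

definition mep_solution ::
  "nat \<Rightarrow> (nat \<Rightarrow> nat) \<Rightarrow> (nat \<Rightarrow> complex mat) \<Rightarrow> (nat \<Rightarrow> nat \<Rightarrow> complex mat) \<Rightarrow>
    (nat \<Rightarrow> complex) \<Rightarrow> (nat \<Rightarrow> complex vec) \<Rightarrow> bool" where
  "mep_solution k m A B l x \<longleftrightarrow>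
    (\<forall>i\<in>{1..k}. A i *\<^sub>v x i =
       finsum_vec TYPE(complex) (m i) (\<lambda>s. l s \<cdot>\<^sub>v (B i s *\<^sub>v x i)) {1..k})"

(* The values range over a set that is bounded below by 0 and, if all n i are positive, nonempty
   (take the perturbed matrices to be 0), so the real infimum is then the proper one. *)
definition theta1 ::
  "nat \<Rightarrow> (nat \<Rightarrow> nat) \<Rightarrow> (nat \<Rightarrow> nat) \<Rightarrow> (nat \<Rightarrow> complex mat) \<Rightarrow>
    (nat \<Rightarrow> nat \<Rightarrow> complex mat) \<Rightarrow> real" where
  "theta1 k m n A B = Inf
    {\<Sum>i=1..k. (frob_norm (hconcat (m i) ((A' i - A i) # map (\<lambda>s. B' i s - B i s) [1..<Suc k])))\<^sup>2
     | A' B' l x.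
       (\<forall>i\<in>{1..k}. A' i \<in> carrier_mat (m i) (n i) \<and>
          (\<forall>s\<in>{1..k}. B' i s \<in> carrier_mat (m i) (n i))) \<and>
       unit_family k n x \<and> mep_solution k m A' B' l x}"

definition sphere_params :: "nat \<Rightarrow> real \<Rightarrow> (nat \<Rightarrow> complex) \<Rightarrow> bool" where
  "sphere_params k g a \<longleftrightarrow> 0 \<le> g \<and> \<bar>g\<bar>\<^sup>2 + (\<Sum>s=1..k. (cmod (a s))\<^sup>2) = 1"

definition homog_objective ::
  "nat \<Rightarrow> (nat \<Rightarrow> nat) \<Rightarrow> (nat \<Rightarrow> complex mat) \<Rightarrow> (nat \<Rightarrow> nat \<Rightarrow> complex mat) \<Rightarrow>
    real \<Rightarrow> (nat \<Rightarrow> complex) \<Rightarrow> (nat \<Rightarrow> complex vec) \<Rightarrow> real" where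
  "homog_objective k m A B g a x =
    (\<Sum>i=1..k. (eucl_norm (complex_of_real g \<cdot>\<^sub>v (A i *\<^sub>v x i) -
       finsum_vec TYPE(complex) (m i) (\<lambda>s. a s \<cdot>\<^sub>v (B i s *\<^sub>v x i)) {1..k}))\<^sup>2)"

end

(* Normalising (1, -l_1, ..., -l_k) to a unit vector w, a feasible perturbation of A_i, B_i1, ..., B_ik
   must cancel the residual \<rho>_i = g A_i x_i - \<Sum>\<^sub>s a_s B_is x_i, and w and x_i being unit vectors,
   Cauchy-Schwarz in every row shows that it costs at least |\<rho>_i|^2. Conversely, if g > 0, subtracting
   the rank one matrix cnj(w_s) \<rho>_i x_i^* from the s-th coefficient cancels the residual at exactly
   that cost. The parameters with g = 0 are limits of parameters with g > 0, so the infimum is the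
   infimum of a continuous function on the compact set of all (g, a, x). *)
theory Submission
  imports Defs "HOL-Analysis.Function_Topology"
begin

section \<open>Homogeneous coefficients and scalar residuals\<close>

definition pencil :: "complex mat \<Rightarrow> (nat \<Rightarrow> complex mat) \<Rightarrow> nat \<Rightarrow> complex mat" where
  "pencil A B s = (if s = 0 then A else B s)"

text \<open>The minus sign moves the right-hand side of the eigenvalue equation to the left, so that
  the leading matrix and all \<open>B s\<close> enter one sum on the same footing. The original
  equation is the case \<open>g = 1\<close>, \<open>a = l\<close>.\<close>

definition weights :: "real \<Rightarrow> (nat \<Rightarrow> complex) \<Rightarrow> nat \<Rightarrow> complex" where
  "weights g a s = (if s = 0 then complex_of_real g else - a s)"

text \<open>A plain double sum, with the vector given as a function on indices: Cauchy-Schwarz can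
  then run over the pairs \<open>(s, j)\<close>, and continuity concerns complex numbers
  only.\<close>

definition residual ::
  "nat \<Rightarrow> nat \<Rightarrow> (nat \<Rightarrow> complex mat) \<Rightarrow> (nat \<Rightarrow> complex) \<Rightarrow> (nat \<Rightarrow> complex) \<Rightarrow> nat \<Rightarrow> complex" where
  "residual k n P w x r = (\<Sum>s=0..k. \<Sum>j<n. w s * P s $$ (r, j) * x j)"

section \<open>Squared norms as sums over entries\<close>

lemma eucl_norm_squared: "(eucl_norm v)\<^sup>2 = (\<Sum>j<dim_vec v. (cmod (v $ j))\<^sup>2)"
  by (simp add: eucl_norm_def L2_set_def sum_nonneg)

lemma eucl_norm_nonneg: "0 \<le> eucl_norm v"
  by (simp add: eucl_norm_def)

lemma eucl_norm_eq_1_iff: "eucl_norm v = 1 \<longleftrightarrow> (\<Sum>j<dim_vec v. (cmod (v $ j))\<^sup>2) = 1"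
  unfolding eucl_norm_squared[symmetric]
  using eucl_norm_nonneg[of v] by (auto simp: power2_eq_1_iff)

lemma frob_norm_squared:
  "(frob_norm M)\<^sup>2 = (\<Sum>r<dim_row M. \<Sum>j<dim_col M. (cmod (M $$ (r, j)))\<^sup>2)"
  by (simp add: frob_norm_def L2_set_def sum_nonneg sum.cartesian_product case_prod_unfold)

lemma frob_norm_squared_cols:
  "(frob_norm M)\<^sup>2 = (\<Sum>v\<leftarrow>cols M. (eucl_norm v)\<^sup>2)"
proof -
  have "(\<Sum>v\<leftarrow>cols M. (eucl_norm v)\<^sup>2) = (\<Sum>j<dim_col M. (eucl_norm (col M j))\<^sup>2)"
    by (simp add: cols_def comp_def interv_sum_list_conv_sum_set_nat atLeast0LessThan)
  also have "\<dots> = (\<Sum>j<dim_col M. \<Sum>r<dim_row M. (cmod (M $$ (r, j)))\<^sup>2)"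
    by (simp add: eucl_norm_squared)
  also have "\<dots> = (frob_norm M)\<^sup>2"
    unfolding frob_norm_squared by (rule sum.swap)
  finally show ?thesis by simp
qed

text \<open>Concatenation only lines up columns, and the squared Frobenius norm is additive over
  columns. The common row count lets \<open>cols\<close> undo \<open>mat_of_cols\<close>.\<close>

lemma frob_norm_squared_hconcat:
  assumes "\<And>M. M \<in> set Ms \<Longrightarrow> dim_row M = r"
  shows "(frob_norm (hconcat r Ms))\<^sup>2 = (\<Sum>M\<leftarrow>Ms. (frob_norm M)\<^sup>2)"
proof -
  have "cols (hconcat r Ms) = concat (map cols Ms)"
    unfolding hconcat_def
  proof (rule cols_mat_of_cols)
    have "set (cols M) \<subseteq> carrier_vec r" if "M \<in> set Ms" for M
      using cols_dim[of M] assms[OF that] by simp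
    then show "set (concat (map cols Ms)) \<subseteq> carrier_vec r" by auto
  qed
  moreover have "(\<Sum>v\<leftarrow>concat xss. f v) = (\<Sum>xs\<leftarrow>xss. \<Sum>v\<leftarrow>xs. f v)"
    for f :: "complex vec \<Rightarrow> real" and xss
    by (induction xss) auto
  ultimately show ?thesis
    by (simp add: frob_norm_squared_cols comp_def)
qed

text \<open>The sum over rows is placed outermost because costs are compared with residuals one row
  at a time.\<close>

lemma frob_norm_squared_pencil:
  assumes "A \<in> carrier_mat r n" "A' \<in> carrier_mat r n"
    and "\<And>s. s \<in> {1..k} \<Longrightarrow> B s \<in> carrier_mat r n" "\<And>s. s \<in> {1..k} \<Longrightarrow> B' s \<in> carrier_mat r n"
  shows "(frob_norm (hconcat r ((A' - A) # map (\<lambda>s. B' s - B s) [1..<Suc k])))\<^sup>2 =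
    (\<Sum>r'<r. \<Sum>s=0..k. \<Sum>j<n. (cmod (pencil A' B' s $$ (r', j) - pencil A B s $$ (r', j)))\<^sup>2)"
proof -
  have "(frob_norm (hconcat r ((A' - A) # map (\<lambda>s. B' s - B s) [1..<Suc k])))\<^sup>2 =
      (frob_norm (A' - A))\<^sup>2 + (\<Sum>s=1..k. (frob_norm (B' s - B s))\<^sup>2)"
    using carrier_matD[OF assms(1)] carrier_matD[OF assms(3)]
    by (subst frob_norm_squared_hconcat)
      (auto simp: comp_def interv_sum_list_conv_sum_set_nat atLeastLessThanSuc_atLeastAtMost
        simp del: upt_Suc)
  also have "\<dots> = (\<Sum>s=0..k. (frob_norm (pencil A' B' s - pencil A B s))\<^sup>2)"
    by (simp add: sum.atLeast_Suc_atMost[of 0 k] pencil_def)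
  also have "\<dots> = (\<Sum>s=0..k. \<Sum>r'<r. \<Sum>j<n.
      (cmod (pencil A' B' s $$ (r', j) - pencil A B s $$ (r', j)))\<^sup>2)"
    using carrier_matD[OF assms(1)] carrier_matD[OF assms(3)]
    by (intro sum.cong) (auto simp: frob_norm_squared pencil_def intro!: sum.cong)
  also have "\<dots> = (\<Sum>r'<r. \<Sum>s=0..k. \<Sum>j<n.
      (cmod (pencil A' B' s $$ (r', j) - pencil A B s $$ (r', j)))\<^sup>2)"
    by (rule sum.swap)
  finally show ?thesis .
qed

section \<open>Vector equations reduced to scalar residuals\<close>

lemma finsum_mult_mat_vec_index:
  fixes B :: "nat \<Rightarrow> complex mat"
  assumes "\<And>s. s \<in> {1..k} \<Longrightarrow> B s \<in> carrier_mat m n" "x \<in> carrier_vec n" "r < m"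
  shows "finsum_vec TYPE(complex) m (\<lambda>s. a s \<cdot>\<^sub>v (B s *\<^sub>v x)) {1..k} $ r =
    (\<Sum>s=1..k. \<Sum>j<n. a s * B s $$ (r, j) * x $ j)"
proof -
  have "(\<lambda>s. a s \<cdot>\<^sub>v (B s *\<^sub>v x)) \<in> {1..k} \<rightarrow> carrier_vec m"
    using assms by fastforce
  then have "finsum_vec TYPE(complex) m (\<lambda>s. a s \<cdot>\<^sub>v (B s *\<^sub>v x)) {1..k} $ r =
      (\<Sum>s=1..k. (a s \<cdot>\<^sub>v (B s *\<^sub>v x)) $ r)"
    using assms by (subst index_finsum_vec) auto
  also have "\<dots> = (\<Sum>s=1..k. \<Sum>j<n. a s * B s $$ (r, j) * x $ j)"
  proof (rule sum.cong[OF refl])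
    fix s assume "s \<in> {1..k}"
    then have "B s \<in> carrier_mat m n" using assms by blast
    then show "(a s \<cdot>\<^sub>v (B s *\<^sub>v x)) $ r = (\<Sum>j<n. a s * B s $$ (r, j) * x $ j)"
      using assms
      by (auto simp: scalar_prod_def sum_distrib_left mult.assoc atLeast0LessThan intro!: sum.cong)
  qed
  finally show ?thesis .
qed

lemma residual_vec:
  assumes "A \<in> carrier_mat m n" "\<And>s. s \<in> {1..k} \<Longrightarrow> B s \<in> carrier_mat m n" "x \<in> carrier_vec n"
  shows "complex_of_real g \<cdot>\<^sub>v (A *\<^sub>v x) - finsum_vec TYPE(complex) m (\<lambda>s. a s \<cdot>\<^sub>v (B s *\<^sub>v x)) {1..k} =
    vec m (residual k n (pencil A B) (weights g a) (($) x))"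
proof -
  have car: "(\<lambda>s. a s \<cdot>\<^sub>v (B s *\<^sub>v x)) \<in> {1..k} \<rightarrow> carrier_vec m"
    using assms by fastforce
  then have dim: "dim_vec (finsum_vec TYPE(complex) m (\<lambda>s. a s \<cdot>\<^sub>v (B s *\<^sub>v x)) {1..k}) = m"
    using finsum_vec_closed carrier_vecD by blast
  show ?thesis
  proof (rule eq_vecI)
    fix r assume "r < dim_vec (vec m (residual k n (pencil A B) (weights g a) (($) x)))"
    then have r: "r < m" by simp
    have "(A *\<^sub>v x) $ r = (\<Sum>j<n. A $$ (r, j) * x $ j)"
      using assms r by (auto simp: scalar_prod_def atLeast0LessThan intro!: sum.cong)
    then show "(complex_of_real g \<cdot>\<^sub>v (A *\<^sub>v x) -
        finsum_vec TYPE(complex) m (\<lambda>s. a s \<cdot>\<^sub>v (B s *\<^sub>v x)) {1..k}) $ r =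
      vec m (residual k n (pencil A B) (weights g a) (($) x)) $ r"
      using r assms finsum_mult_mat_vec_index[of k B m n x r a] dim
      by (simp add: residual_def sum.atLeast_Suc_atMost[of 0 k] pencil_def weights_def
          sum_distrib_left sum_negf mult.assoc)
  qed (use dim in simp)
qed

lemma homog_objective_residual:
  assumes "\<And>i. i \<in> {1..k} \<Longrightarrow> A i \<in> carrier_mat (m i) (n i)"
    and "\<And>i s. i \<in> {1..k} \<Longrightarrow> s \<in> {1..k} \<Longrightarrow> B i s \<in> carrier_mat (m i) (n i)"
    and "\<And>i. i \<in> {1..k} \<Longrightarrow> x i \<in> carrier_vec (n i)"
  shows "homog_objective k m A B g a x = (\<Sum>i=1..k. \<Sum>r<m i.
    (cmod (residual k (n i) (pencil (A i) (B i)) (weights g a) (($) (x i)) r))\<^sup>2)"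
  unfolding homog_objective_def
proof (rule sum.cong[OF refl])
  fix i assume i: "i \<in> {1..k}"
  show "(eucl_norm (complex_of_real g \<cdot>\<^sub>v (A i *\<^sub>v x i) -
       finsum_vec TYPE(complex) (m i) (\<lambda>s. a s \<cdot>\<^sub>v (B i s *\<^sub>v x i)) {1..k}))\<^sup>2 = (\<Sum>r<m i.
    (cmod (residual k (n i) (pencil (A i) (B i)) (weights g a) (($) (x i)) r))\<^sup>2)"
    by (subst residual_vec[of _ _ "n i"]) (use assms i in \<open>auto simp: eucl_norm_squared\<close>)
qed

text \<open>With \<open>g = 1\<close> the residual is the difference of the two sides of the
  equation, read row by row.\<close>

lemma mep_solution_residual:
  assumes "\<And>i. i \<in> {1..k} \<Longrightarrow> A i \<in> carrier_mat (m i) (n i)"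
    and "\<And>i s. i \<in> {1..k} \<Longrightarrow> s \<in> {1..k} \<Longrightarrow> B i s \<in> carrier_mat (m i) (n i)"
    and "\<And>i. i \<in> {1..k} \<Longrightarrow> x i \<in> carrier_vec (n i)"
  shows "mep_solution k m A B l x \<longleftrightarrow> (\<forall>i\<in>{1..k}. \<forall>r<m i.
    residual k (n i) (pencil (A i) (B i)) (weights 1 l) (($) (x i)) r = 0)"
  unfolding mep_solution_def
proof (rule ball_cong[OF refl])
  fix i assume i: "i \<in> {1..k}"
  let ?v = "finsum_vec TYPE(complex) (m i) (\<lambda>s. l s \<cdot>\<^sub>v (B i s *\<^sub>v x i)) {1..k}"
  have car: "(\<lambda>s. l s \<cdot>\<^sub>v (B i s *\<^sub>v x i)) \<in> {1..k} \<rightarrow> carrier_vec (m i)"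
    using assms i by fastforce
  then have v: "?v \<in> carrier_vec (m i)"
    by (rule finsum_vec_closed)
  have u: "A i *\<^sub>v x i \<in> carrier_vec (m i)"
    using assms i by fastforce
  have "A i *\<^sub>v x i - ?v =
    vec (m i) (residual k (n i) (pencil (A i) (B i)) (weights 1 l) (($) (x i)))"
    using residual_vec[of "A i" "m i" "n i" k "B i" "x i" 1 l] assms i by simp
  then have diff: "(A i *\<^sub>v x i) $ r - ?v $ r =
      residual k (n i) (pencil (A i) (B i)) (weights 1 l) (($) (x i)) r" if "r < m i" for r
    using that v index_minus_vec(1)[of r ?v "A i *\<^sub>v x i"] by simp
  have "p = q \<longleftrightarrow> (\<forall>r<m i. p $ r - q $ r = 0)"
    if "p \<in> carrier_vec (m i)" "q \<in> carrier_vec (m i)" for p q :: "complex vec"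
    using that by (auto intro!: eq_vecI)
  from this[OF u v] show "A i *\<^sub>v x i = ?v \<longleftrightarrow> (\<forall>r<m i.
    residual k (n i) (pencil (A i) (B i)) (weights 1 l) (($) (x i)) r = 0)"
    by (simp flip: diff)
qed

section \<open>The lower bound in a single row\<close>

lemma weights_sphere:
  "sphere_params k g a \<longleftrightarrow> 0 \<le> g \<and> (\<Sum>s=0..k. (cmod (weights g a s))\<^sup>2) = 1"
  by (simp add: sphere_params_def sum.atLeast_Suc_atMost[of 0 k] weights_def)

text \<open>The tensor product of two unit vectors is a unit vector. This is the normalisation
  behind the Cauchy-Schwarz bound, the cancellation of the residual and the cost of the optimal
  perturbation.\<close>

lemma sum_prod_weights:
  fixes w x :: "nat \<Rightarrow> complex"
  assumes "(\<Sum>s=0..k. (cmod (w s))\<^sup>2) = 1" "(\<Sum>j<n. (cmod (x j))\<^sup>2) = 1"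
  shows "(\<Sum>s=0..k. \<Sum>j<n. (cmod (w s * x j))\<^sup>2) = 1"
  using assms by (simp add: norm_mult power_mult_distrib flip: sum_product)

text \<open>As the residual of \<open>P'\<close> vanishes, that of \<open>P\<close> is up to sign
  the sum of the products of \<open>w s * x j\<close> with the entries of \<open>P' - P\<close>. The
  first factor has norm 1, so Cauchy-Schwarz leaves only the norm of the change.\<close>

lemma residual_cauchy_schwarz:
  assumes "(\<Sum>s=0..k. (cmod (w s))\<^sup>2) = 1" "(\<Sum>j<n. (cmod (x j))\<^sup>2) = 1"
    and "residual k n P' w x r = 0"
  shows "(cmod (residual k n P w x r))\<^sup>2 \<le>
    (\<Sum>s=0..k. \<Sum>j<n. (cmod (P' s $$ (r, j) - P s $$ (r, j)))\<^sup>2)"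
proof -
  let ?I = "{0..k} \<times> {..<n}"
  let ?f = "\<lambda>q. cmod (w (fst q) * x (snd q))"
  let ?d = "\<lambda>q. cmod (P' (fst q) $$ (r, snd q) - P (fst q) $$ (r, snd q))"
  have "residual k n P w x r = residual k n P w x r - residual k n P' w x r"
    using assms by simp
  also have "\<dots> = - (\<Sum>q\<in>?I. (w (fst q) * x (snd q)) *
      (P' (fst q) $$ (r, snd q) - P (fst q) $$ (r, snd q)))"
    by (simp add: residual_def sum.cartesian_product case_prod_unfold algebra_simps
        flip: sum_subtractf sum_negf)
  finally have "cmod (residual k n P w x r) \<le> (\<Sum>q\<in>?I. ?f q * ?d q)"
    by (simp add: norm_minus_cancel) (rule order_trans[OF norm_sum], simp add: norm_mult)
  also have "\<dots> \<le> L2_set ?f ?I * L2_set ?d ?I"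
    using L2_set_mult_ineq[of ?f ?d ?I] by simp
  also have "L2_set ?f ?I = 1"
    using sum_prod_weights[OF assms(1,2)]
    by (simp add: L2_set_def sum.cartesian_product case_prod_unfold)
  finally have "(cmod (residual k n P w x r))\<^sup>2 \<le> (L2_set ?d ?I)\<^sup>2"
    by (simp add: power_mono)
  also have "\<dots> = (\<Sum>s=0..k. \<Sum>j<n. (cmod (P' s $$ (r, j) - P s $$ (r, j)))\<^sup>2)"
    by (simp add: L2_set_def sum_nonneg sum.cartesian_product case_prod_unfold)
  finally show ?thesis .
qed

section \<open>Scaling of the weights, and the optimal perturbation\<close>

lemma residual_cong:
  assumes "\<And>s j. s \<le> k \<Longrightarrow> j < n \<Longrightarrow> w s * P s $$ (r, j) * x j = w' s * P' s $$ (r, j) * x' j"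
  shows "residual k n P w x r = residual k n P' w' x' r"
  using assms by (auto simp: residual_def intro!: sum.cong)

text \<open>Homogeneity allows passing between weights with leading entry 1 and weights on the unit
  sphere without losing the vanishing of a residual.\<close>

lemma residual_scale: "residual k n P (\<lambda>s. c * w s) x r = c * residual k n P w x r"
  by (simp add: residual_def sum_distrib_left mult.assoc)

lemma weights_scale: "weights (c * g) (\<lambda>s. complex_of_real c * a s) = (\<lambda>s. complex_of_real c * weights g a s)"
  by (auto simp: weights_def)

text \<open>In each row this is a multiple of the conjugate of the tensor \<open>w s * x j\<close>,
  which is the equality case of Cauchy-Schwarz.\<close>

definition perturbation :: "(nat \<Rightarrow> complex) \<Rightarrow> (nat \<Rightarrow> complex) \<Rightarrow> (nat \<Rightarrow> complex) \<Rightarrow> nat \<Rightarrow> nat \<Rightarrow> nat \<Rightarrow> complex mat" where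
  "perturbation \<rho> w x m n s = mat m n (\<lambda>(r, j). - (\<rho> r * cnj (w s) * cnj (x j)))"

text \<open>The entry at \<open>(s, j)\<close> lowers the residual by its
  \<open>(cmod (w s * x j))\<^sup>2\<close>-fold, and these factors add up to 1.\<close>

lemma residual_perturbation:
  assumes "(\<Sum>s=0..k. (cmod (w s))\<^sup>2) = 1" "(\<Sum>j<n. (cmod (x j))\<^sup>2) = 1" "r < m"
    and "\<And>s. s \<le> k \<Longrightarrow> P s \<in> carrier_mat m n"
  shows "residual k n (\<lambda>s. P s + perturbation (residual k n P w x) w x m n s) w x r = 0"
proof -
  let ?\<rho> = "residual k n P w x"
  have "residual k n (\<lambda>s. P s + perturbation ?\<rho> w x m n s) w x r =
    (\<Sum>s=0..k. \<Sum>j<n. w s * P s $$ (r, j) * x j -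
      ?\<rho> r * complex_of_real ((cmod (w s * x j))\<^sup>2))"
    unfolding residual_def[of k n "\<lambda>s. P s + perturbation ?\<rho> w x m n s"]
  proof (intro sum.cong refl)
    fix s j assume sj: "s \<in> {0..k}" "j \<in> {..<n}"
    then have "P s \<in> carrier_mat m n" using assms(4) by simp
    then show "w s * (P s + perturbation ?\<rho> w x m n s) $$ (r, j) * x j =
        w s * P s $$ (r, j) * x j - ?\<rho> r * complex_of_real ((cmod (w s * x j))\<^sup>2)"
      using sj assms(3) unfolding complex_norm_square
      by (simp add: perturbation_def algebra_simps)
  qed
  also have "\<dots> = ?\<rho> r -
      ?\<rho> r * complex_of_real (\<Sum>s=0..k. \<Sum>j<n. (cmod (w s * x j))\<^sup>2)"
    by (simp only: sum_subtractf of_real_sum sum_distrib_left residual_def[of k n P w x r, symmetric])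
  finally show ?thesis using sum_prod_weights[OF assms(1,2)] by simp
qed

text \<open>The entries have modulus \<open>cmod (\<rho> r)\<close> times
  \<open>cmod (w s * x j)\<close>, so the same normalisation shows that the lower bound is met with
  equality.\<close>

lemma frob_perturbation:
  assumes "(\<Sum>s=0..k. (cmod (w s))\<^sup>2) = 1" "(\<Sum>j<n. (cmod (x j))\<^sup>2) = 1" "r < m"
  shows "(\<Sum>s=0..k. \<Sum>j<n. (cmod (perturbation \<rho> w x m n s $$ (r, j)))\<^sup>2) = (cmod (\<rho> r))\<^sup>2"
proof -
  have "(\<Sum>s=0..k. \<Sum>j<n. (cmod (perturbation \<rho> w x m n s $$ (r, j)))\<^sup>2) =
      (\<Sum>s=0..k. \<Sum>j<n. (cmod (\<rho> r))\<^sup>2 * (cmod (w s * x j))\<^sup>2)"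
    using assms(3) by (simp add: perturbation_def norm_mult power_mult_distrib mult.assoc)
  then show ?thesis
    unfolding sum_distrib_left[symmetric] sum_prod_weights[OF assms(1,2)] by simp
qed

section \<open>Costs of feasible perturbations against the homogeneous objective\<close>

lemma unit_family_iff:
  "unit_family k n x \<longleftrightarrow> (\<forall>i\<in>{1..k}. x i \<in> carrier_vec (n i) \<and> (\<Sum>j<n i. (cmod (x i $ j))\<^sup>2) = 1)"
  by (auto simp: unit_family_def eucl_norm_eq_1_iff)

definition mep_costs ::
  "nat \<Rightarrow> (nat \<Rightarrow> nat) \<Rightarrow> (nat \<Rightarrow> nat) \<Rightarrow> (nat \<Rightarrow> complex mat) \<Rightarrow>
    (nat \<Rightarrow> nat \<Rightarrow> complex mat) \<Rightarrow> real set" where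
  "mep_costs k m n A B =
    {\<Sum>i=1..k. (frob_norm (hconcat (m i) ((A' i - A i) # map (\<lambda>s. B' i s - B i s) [1..<Suc k])))\<^sup>2
     | A' B' l x.
       (\<forall>i\<in>{1..k}. A' i \<in> carrier_mat (m i) (n i) \<and>
          (\<forall>s\<in>{1..k}. B' i s \<in> carrier_mat (m i) (n i))) \<and>
       unit_family k n x \<and> mep_solution k m A' B' l x}"

lemma theta1_eq_Inf_mep_costs: "theta1 k m n A B = Inf (mep_costs k m n A B)"
  unfolding theta1_def mep_costs_def ..

lemma mep_costs_nonneg: "c \<in> mep_costs k m n A B \<Longrightarrow> 0 \<le> c"
  by (auto simp: mep_costs_def intro!: sum_nonneg)

context
  fixes k :: nat and m n :: "nat \<Rightarrow> nat"
    and A :: "nat \<Rightarrow> complex mat" and B :: "nat \<Rightarrow> nat \<Rightarrow> complex mat"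
  assumes A_carrier: "\<And>i. i \<in> {1..k} \<Longrightarrow> A i \<in> carrier_mat (m i) (n i)"
    and B_carrier: "\<And>i s. i \<in> {1..k} \<Longrightarrow> s \<in> {1..k} \<Longrightarrow> B i s \<in> carrier_mat (m i) (n i)"
begin

lemma homog_objective_eq:
  assumes "unit_family k n x"
  shows "homog_objective k m A B g a x = (\<Sum>i=1..k. \<Sum>r<m i.
    (cmod (residual k (n i) (pencil (A i) (B i)) (weights g a) (($) (x i)) r))\<^sup>2)"
  by (rule homog_objective_residual)
    (use assms in \<open>auto simp: A_carrier B_carrier unit_family_iff\<close>)

text \<open>The vectors of the feasible tuple are kept and only the eigenvalue tuple is normalised;
  the bound is then the Cauchy-Schwarz estimate added over all rows and all
  \<open>i\<close>.\<close>

lemma mep_cost_ge_homog_objective: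
  assumes "c \<in> mep_costs k m n A B"
  shows "\<exists>g a x. sphere_params k g a \<and> unit_family k n x \<and> homog_objective k m A B g a x \<le> c"
proof -
  obtain A' B' l x where c: "c = (\<Sum>i=1..k. (frob_norm (hconcat (m i)
        ((A' i - A i) # map (\<lambda>s. B' i s - B i s) [1..<Suc k])))\<^sup>2)"
    and A': "\<And>i. i \<in> {1..k} \<Longrightarrow> A' i \<in> carrier_mat (m i) (n i)"
    and B': "\<And>i s. i \<in> {1..k} \<Longrightarrow> s \<in> {1..k} \<Longrightarrow> B' i s \<in> carrier_mat (m i) (n i)"
    and x: "unit_family k n x" and sol: "mep_solution k m A' B' l x"
    using assms unfolding mep_costs_def by blast
  have x_carrier: "\<And>i. i \<in> {1..k} \<Longrightarrow> x i \<in> carrier_vec (n i)"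
    and x_unit: "\<And>i. i \<in> {1..k} \<Longrightarrow> (\<Sum>j<n i. (cmod (x i $ j))\<^sup>2) = 1"
    using x by (auto simp: unit_family_iff)
  \<comment> \<open>\<open>N\<close> is the squared norm of \<open>weights 1 l\<close>. It is at
    least 1 because of the leading entry, so dividing by its root is safe.\<close>
  define N where "N = 1 + (\<Sum>s=1..k. (cmod (l s))\<^sup>2)"
  have N: "N \<ge> 1" by (simp add: N_def sum_nonneg)
  define g where "g = 1 / sqrt N"
  define a where "a = (\<lambda>s. complex_of_real g * l s)"
  have g: "g \<ge> 0" "g\<^sup>2 = 1 / N" using N by (auto simp: g_def power_divide)
  have "\<bar>g\<bar>\<^sup>2 + (\<Sum>s=1..k. (cmod (a s))\<^sup>2) = g\<^sup>2 * N"
    using g(1) by (simp add: a_def norm_mult power_mult_distrib N_def algebra_simps sum_distrib_left)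
  then have sphere: "sphere_params k g a"
    using g N by (simp add: sphere_params_def)
  have w: "weights g a = (\<lambda>s. complex_of_real g * weights 1 l s)"
    using weights_scale[of g 1 l] by (simp add: a_def)
  have "homog_objective k m A B g a x \<le> c"
    unfolding c homog_objective_eq[OF x]
  proof (rule sum_mono)
    fix i assume i: "i \<in> {1..k}"
    have "(\<Sum>r<m i. (cmod (residual k (n i) (pencil (A i) (B i)) (weights g a) (($) (x i)) r))\<^sup>2) \<le>
        (\<Sum>r<m i. \<Sum>s=0..k. \<Sum>j<n i.
          (cmod (pencil (A' i) (B' i) s $$ (r, j) - pencil (A i) (B i) s $$ (r, j)))\<^sup>2)"
    proof (intro sum_mono residual_cauchy_schwarz)
      fix r assume r: "r \<in> {..<m i}"
      have "residual k (n i) (pencil (A' i) (B' i)) (weights 1 l) (($) (x i)) r = 0"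
        using sol mep_solution_residual[of k A' m n B' x l] A' B' x_carrier i r by blast
      then show "residual k (n i) (pencil (A' i) (B' i)) (weights g a) (($) (x i)) r = 0"
        unfolding w residual_scale by simp
    qed (use sphere x_unit i in \<open>auto simp: weights_sphere\<close>)
    also have "\<dots> = (frob_norm (hconcat (m i)
        ((A' i - A i) # map (\<lambda>s. B' i s - B i s) [1..<Suc k])))\<^sup>2"
      by (rule frob_norm_squared_pencil[symmetric]) (use A_carrier B_carrier A' B' i in auto)
    finally show "(\<Sum>r<m i. (cmod (residual k (n i) (pencil (A i) (B i)) (weights g a) (($) (x i)) r))\<^sup>2) \<le>
      (frob_norm (hconcat (m i) ((A' i - A i) # map (\<lambda>s. B' i s - B i s) [1..<Suc k])))\<^sup>2" .
  qed
  with sphere x show ?thesis by blast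
qed

text \<open>Positivity of \<open>g\<close> is what makes the parameters come from finite
  eigenvalues, namely \<open>a s / g\<close>.\<close>

lemma homog_objective_in_mep_costs:
  assumes "sphere_params k g a" "0 < g" and x: "unit_family k n x"
  shows "homog_objective k m A B g a x \<in> mep_costs k m n A B"
proof -
  have x_carrier: "\<And>i. i \<in> {1..k} \<Longrightarrow> x i \<in> carrier_vec (n i)"
    and x_unit: "\<And>i. i \<in> {1..k} \<Longrightarrow> (\<Sum>j<n i. (cmod (x i $ j))\<^sup>2) = 1"
    using x by (auto simp: unit_family_iff)
  have w: "(\<Sum>s=0..k. (cmod (weights g a s))\<^sup>2) = 1"
    using assms by (simp add: weights_sphere)
  define P where "P i = pencil (A i) (B i)" for i
  define D where "D i = perturbation (residual k (n i) (P i) (weights g a) (($) (x i)))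
    (weights g a) (($) (x i)) (m i) (n i)" for i
  \<comment> \<open>Slot 0 of the perturbation belongs to the leading matrix, slot \<open>s\<close>
    to \<open>B i s\<close>, so the perturbed pencil is \<open>P i s + D i s\<close> for every
    \<open>s\<close>.\<close>
  define A' where "A' i = A i + D i 0" for i
  define B' where "B' i s = B i s + D i s" for i s
  \<comment> \<open>Dividing the weights by \<open>g\<close> restores the leading weight 1 required
    by the eigenvalue equation.\<close>
  define l where "l = (\<lambda>s. complex_of_real (1 / g) * a s)"
  have P: "P i s \<in> carrier_mat (m i) (n i)" if "i \<in> {1..k}" "s \<le> k" for i s
    using that A_carrier B_carrier by (auto simp: P_def pencil_def)
  have D: "D i s \<in> carrier_mat (m i) (n i)" for i s
    by (simp add: D_def perturbation_def)
  have A': "A' i \<in> carrier_mat (m i) (n i)" for i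
    using D by (simp add: A'_def)
  have B': "B' i s \<in> carrier_mat (m i) (n i)" for i s
    using D by (simp add: B'_def)
  have P': "pencil (A' i) (B' i) = (\<lambda>s. P i s + D i s)" for i
    by (auto simp: pencil_def P_def A'_def B'_def)
  have wl: "weights 1 l = (\<lambda>s. complex_of_real (1 / g) * weights g a s)"
    using weights_scale[of "1 / g" g a] assms by (simp add: l_def)
  have sol: "mep_solution k m A' B' l x"
  proof (subst mep_solution_residual[where n = n])
    show "\<forall>i\<in>{1..k}. \<forall>r<m i.
        residual k (n i) (pencil (A' i) (B' i)) (weights 1 l) (($) (x i)) r = 0"
    proof (intro ballI allI impI)
      fix i r assume "i \<in> {1..k}" "r < m i"
      then show "residual k (n i) (pencil (A' i) (B' i)) (weights 1 l) (($) (x i)) r = 0"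
        unfolding P' wl residual_scale D_def
        by (subst residual_perturbation[OF w x_unit]) (use P in auto)
    qed
  qed (use A' B' x_carrier in auto)
  have "homog_objective k m A B g a x = (\<Sum>i=1..k. (frob_norm (hconcat (m i)
        ((A' i - A i) # map (\<lambda>s. B' i s - B i s) [1..<Suc k])))\<^sup>2)"
    unfolding homog_objective_eq[OF x]
  proof (rule sum.cong[OF refl])
    fix i assume i: "i \<in> {1..k}"
    have "(frob_norm (hconcat (m i) ((A' i - A i) # map (\<lambda>s. B' i s - B i s) [1..<Suc k])))\<^sup>2 =
      (\<Sum>r<m i. \<Sum>s=0..k. \<Sum>j<n i. (cmod (pencil (A' i) (B' i) s $$ (r, j) - P i s $$ (r, j)))\<^sup>2)"
      unfolding P_def
      by (rule frob_norm_squared_pencil) (use A_carrier B_carrier A' B' i in auto)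
    also have "\<dots> = (\<Sum>r<m i. \<Sum>s=0..k. \<Sum>j<n i. (cmod (D i s $$ (r, j)))\<^sup>2)"
    proof (intro sum.cong refl)
      fix r s j assume "r \<in> {..<m i}" "s \<in> {0..k}" "j \<in> {..<n i}"
      then show "(cmod (pencil (A' i) (B' i) s $$ (r, j) - P i s $$ (r, j)))\<^sup>2 =
          (cmod (D i s $$ (r, j)))\<^sup>2"
        using P[OF i, of s] D[of i s] by (simp add: P')
    qed
    also have "\<dots> = (\<Sum>r<m i. (cmod (residual k (n i) (P i) (weights g a) (($) (x i)) r))\<^sup>2)"
      unfolding D_def by (intro sum.cong refl frob_perturbation w x_unit i) simp
    finally show "(\<Sum>r<m i. (cmod (residual k (n i) (pencil (A i) (B i)) (weights g a) (($) (x i)) r))\<^sup>2) =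
      (frob_norm (hconcat (m i) ((A' i - A i) # map (\<lambda>s. B' i s - B i s) [1..<Suc k])))\<^sup>2"
      by (simp add: P_def)
  qed
  with A' B' x sol show ?thesis
    unfolding mep_costs_def by blast
qed

text \<open>For \<open>g > 0\<close> the objective value is itself a cost. The case
  \<open>g = 0\<close> stands for eigenvalues at infinity and is reached as a limit.\<close>

lemma theta1_le_homog_objective:
  assumes "sphere_params k g a" and x: "unit_family k n x"
  shows "theta1 k m n A B \<le> homog_objective k m A B g a x"
proof -
  have le: "theta1 k m n A B \<le> homog_objective k m A B g' a' x"
    if "sphere_params k g' a'" "0 < g'" for g' a'
    unfolding theta1_eq_Inf_mep_costs
    by (rule cInf_lower[OF homog_objective_in_mep_costs[OF that x]])
      (rule bdd_belowI, erule mep_costs_nonneg)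
  show ?thesis
  proof (cases "0 < g")
    case True
    with assms le show ?thesis by blast
  next
    case False
    then have g: "g = 0" and a: "(\<Sum>s=1..k. (cmod (a s))\<^sup>2) = 1"
      using assms by (auto simp: sphere_params_def)
    \<comment> \<open>The factor keeps \<open>(e, a' e)\<close> on the sphere for \<open>e\<close>
      between 0 and 1, and \<open>a' 0\<close> is \<open>a\<close>.\<close>
    define a' where "a' e s = complex_of_real (sqrt (1 - e\<^sup>2)) * a s" for e s
    \<comment> \<open>The vectors stay fixed, so the objective depends on \<open>e\<close> only
      through finitely many weights.\<close>
    have "((\<lambda>e. weights e (a' e) s) \<longlongrightarrow> weights 0 (a' 0) s) (at_right 0)" for s
      unfolding weights_def a'_def by (cases "s = 0") (auto intro!: tendsto_eq_intros)
    then have "((\<lambda>e. homog_objective k m A B e (a' e) x) \<longlongrightarrow>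
        homog_objective k m A B 0 (a' 0) x) (at_right 0)"
      unfolding homog_objective_eq[OF x] residual_def
      by (intro tendsto_intros)
    moreover have "a' 0 = a" by (auto simp: a'_def)
    moreover have "\<forall>\<^sub>F e in at_right 0. theta1 k m n A B \<le> homog_objective k m A B e (a' e) x"
    proof -
      have "theta1 k m n A B \<le> homog_objective k m A B e (a' e) x" if "0 < e" "e < 1" for e
      proof (rule le)
        have "e\<^sup>2 \<le> 1" using that by (simp add: power_le_one)
        then show "sphere_params k e (a' e)"
          using that a
          by (simp add: sphere_params_def a'_def norm_mult power_mult_distrib flip: sum_distrib_left)
      qed (use that in simp)
      then show ?thesis
        by (auto simp: eventually_at_right_field intro!: exI[of _ 1])
    qed
    ultimately show ?thesis
      using g by (auto intro: tendsto_lowerbound)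
  qed
qed

section \<open>Attainment of the minimum by compactness\<close>

lemma homog_objective_attains_min:
  assumes "\<And>i. i \<in> {1..k} \<Longrightarrow> 1 \<le> n i"
  shows "\<exists>g a x. sphere_params k g a \<and> unit_family k n x \<and>
    (\<forall>g' a' x'. sphere_params k g' a' \<and> unit_family k n x' \<longrightarrow>
      homog_objective k m A B g a x \<le> homog_objective k m A B g' a' x')"
proof -
  \<comment> \<open>The type of complex vectors carries no topology, so a triple (g, a, x) is encoded as a function
    on pairs, with g at (0, 0), a s at (0, s) and x i $ j at (i, j), in a compact product space.\<close>
  define square where "square = (\<lambda>(u, v). Complex u v) ` ({-1..1} \<times> {-1..1})"
  have "continuous_on ({-1..1} \<times> {-1..1}) (\<lambda>(u, v). Complex u v)"
    unfolding case_prod_unfold by (intro continuous_intros)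
  then have compact_square: "compact square"
    unfolding square_def by (intro compact_continuous_image compact_Times compact_Icc)
  have in_square: "z \<in> square" if "cmod z \<le> 1" for z
  proof -
    have "\<bar>Re z\<bar> \<le> 1" "\<bar>Im z\<bar> \<le> 1"
      using that abs_Re_le_cmod abs_Im_le_cmod order_trans by blast+
    then show ?thesis
      unfolding square_def by (intro image_eqI[of _ _ "(Re z, Im z)"]) auto
  qed
  define K :: "(nat \<times> nat \<Rightarrow> complex) set" where
    "K = (\<Pi>\<^sub>E q\<in>UNIV. square) \<inter>
      ({p. Im (p (0, 0)) = 0} \<inter> {p. 0 \<le> Re (p (0, 0))} \<inter>
       {p. (cmod (p (0, 0)))\<^sup>2 + (\<Sum>s=1..k. (cmod (p (0, s)))\<^sup>2) = 1} \<inter>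
       (\<Inter>i\<in>{1..k}. {p. (\<Sum>j<n i. (cmod (p (i, j)))\<^sup>2) = 1}))"
  define dec_g where "dec_g p = Re (p (0, 0))" for p :: "nat \<times> nat \<Rightarrow> complex"
  define dec_a where "dec_a p s = p (0, s)" for p :: "nat \<times> nat \<Rightarrow> complex" and s
  define dec_x where "dec_x p i = vec (n i) (\<lambda>j. p (i, j))" for p :: "nat \<times> nat \<Rightarrow> complex" and i
  define F where "F p = homog_objective k m A B (dec_g p) (dec_a p) (dec_x p)" for p
  have cont: "continuous_on S (\<lambda>p. p q)" for S and q :: "nat \<times> nat"
    by (rule continuous_on_subset[OF continuous_on_product_coordinates]) simp
  have "compactin (product_topology (\<lambda>q::nat \<times> nat. euclidean) UNIV)
      (\<Pi>\<^sub>E q\<in>UNIV. square)"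
    by (subst compactin_PiE) (simp add: compact_square)
  then have "compact (\<Pi>\<^sub>E q\<in>(UNIV::(nat \<times> nat) set). square)"
    by (simp add: euclidean_product_topology)
  then have compact: "compact K"
    unfolding K_def
    by (intro compact_Int_closed closed_Int closed_INT ballI closed_Collect_eq closed_Collect_le
        continuous_intros cont)
  have dec: "sphere_params k (dec_g p) (dec_a p)" "unit_family k n (dec_x p)" if "p \<in> K" for p
    using that by (auto simp: K_def sphere_params_def unit_family_iff dec_g_def dec_a_def
        dec_x_def cmod_power2)
  \<comment> \<open>This removes the type of vectors from \<open>F\<close> on \<open>K\<close>,
    leaving a polynomial expression in coordinates and moduli whose continuity can be
    checked.\<close>
  have F_eq: "F p = (\<Sum>i=1..k. \<Sum>r<m i. (cmod (residual k (n i) (pencil (A i) (B i))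
    (weights (dec_g p) (dec_a p)) (\<lambda>j. p (i, j)) r))\<^sup>2)" if "p \<in> K" for p
    unfolding F_def homog_objective_eq[OF dec(2)[OF that]]
    by (intro sum.cong refl arg_cong[where f = "\<lambda>z. (cmod z)\<^sup>2"] residual_cong)
      (simp add: dec_x_def)
  have "continuous_on K (\<lambda>p. weights (dec_g p) (dec_a p) s)" for s
    unfolding weights_def dec_g_def dec_a_def by (cases "s = 0") (auto intro!: continuous_intros cont)
  then have "continuous_on K (\<lambda>p. \<Sum>i=1..k. \<Sum>r<m i. (cmod (residual k (n i) (pencil (A i) (B i))
    (weights (dec_g p) (dec_a p)) (\<lambda>j. p (i, j)) r))\<^sup>2)"
    unfolding residual_def by (intro continuous_intros cont)
  then have continuous: "continuous_on K F"
    using F_eq by (simp cong: continuous_on_cong)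
  have enc: "\<exists>p\<in>K. F p = homog_objective k m A B g a x"
    if sph: "sphere_params k g a" and x: "unit_family k n x" for g a x
  proof -
    \<comment> \<open>Outside the relevant indices \<open>a\<close> and \<open>x\<close> are
      unrestricted and might leave \<open>square\<close>, so they are replaced by 0 there.\<close>
    define p where "p = (\<lambda>(i, j).
      if i = 0 then (if j = 0 then complex_of_real g else if j \<le> k then a j else 0)
      else if i \<le> k \<and> j < n i then x i $ j else 0)"
    have le1: "cmod (f s) \<le> 1" if "(\<Sum>s\<in>I. (cmod (f s))\<^sup>2) \<le> 1" "finite I" "s \<in> I"
      for f :: "nat \<Rightarrow> complex" and I s
    proof -
      have "(cmod (f s))\<^sup>2 \<le> (\<Sum>s\<in>I. (cmod (f s))\<^sup>2)"
        using that by (intro member_le_sum) auto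
      with that(1) have "(cmod (f s))\<^sup>2 \<le> 1" by (rule order_trans[rotated])
      then show ?thesis using power2_le_imp_le[of "cmod (f s)" 1] by simp
    qed
    have a_sum: "(\<Sum>s=1..k. (cmod (a s))\<^sup>2) \<le> 1"
      using sph unfolding sphere_params_def by (smt (verit) zero_le_power2)
    have g1: "g\<^sup>2 \<le> 1"
      using sph sum_nonneg[of "{1..k}" "\<lambda>s. (cmod (a s))\<^sup>2"] by (simp add: sphere_params_def)
    have g: "0 \<le> g" "g \<le> 1"
      using sph g1 by (auto simp: sphere_params_def abs_square_le_1)
    have "cmod (a j) \<le> 1" if "j \<noteq> 0" "j \<le> k" for j
      using le1[OF a_sum] that by simp
    moreover have "cmod (x i $ j) \<le> 1" if "i \<noteq> 0" "i \<le> k" "j < n i" for i j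
    proof -
      have "i \<in> {1..k}" using that by simp
      then have "(\<Sum>j<n i. (cmod (x i $ j))\<^sup>2) \<le> 1"
        using x unfolding unit_family_iff by simp
      from le1[OF this] that show ?thesis by simp
    qed
    ultimately have "cmod (p q) \<le> 1" for q
      using g by (cases q) (simp add: p_def)
    then have "p \<in> (\<Pi>\<^sub>E q\<in>UNIV. square)"
      using in_square by auto
    then have K: "p \<in> K"
      using sph x by (auto simp: K_def p_def sphere_params_def unit_family_iff)
    have "dec_g p = g" by (simp add: dec_g_def p_def)
    \<comment> \<open>Decoding \<open>p\<close> need not return \<open>a\<close> and
      \<open>x\<close> themselves, for instance \<open>dec_a p 0\<close> is \<open>g\<close>. It
      agrees with them at all indices that enter the residuals.\<close>
    then have "F p = homog_objective k m A B g a x"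
      unfolding F_eq[OF K] homog_objective_eq[OF x]
      by (intro sum.cong refl arg_cong[where f = "\<lambda>z. (cmod z)\<^sup>2"] residual_cong)
        (simp add: weights_def dec_a_def p_def)
    with K show ?thesis by blast
  qed
  \<comment> \<open>A feasible triple, showing \<open>K\<close> nonempty; the first unit vector of
    each space exists because \<open>1 \<le> n i\<close>.\<close>
  have "sphere_params k 1 (\<lambda>_. 0)" by (simp add: sphere_params_def)
  moreover have "unit_family k n (\<lambda>i. unit_vec (n i) 0)"
  proof -
    have "(\<Sum>j<n i. (cmod (unit_vec (n i) 0 $ j))\<^sup>2) = 1" if "i \<in> {1..k}" for i
    proof -
      have "(\<Sum>j<n i. (cmod (unit_vec (n i) 0 $ j))\<^sup>2) = (\<Sum>j<n i. if j = 0 then 1 else 0)"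
        by (intro sum.cong) auto
      then show ?thesis using assms[OF that] by simp
    qed
    then show ?thesis by (simp add: unit_family_iff)
  qed
  ultimately have "K \<noteq> {}" using enc by blast
  from continuous_attains_inf[OF compact this continuous]
  obtain p where p: "p \<in> K" "\<And>q. q \<in> K \<Longrightarrow> F p \<le> F q" by blast
  show ?thesis
  proof (intro exI conjI allI impI)
    show "sphere_params k (dec_g p) (dec_a p)" "unit_family k n (dec_x p)"
      using dec p by auto
    fix g' a' x' assume "sphere_params k g' a' \<and> unit_family k n x'"
    with enc obtain q where "q \<in> K" "F q = homog_objective k m A B g' a' x'" by blast
    with p show "homog_objective k m A B (dec_g p) (dec_a p) (dec_x p) \<le>
        homog_objective k m A B g' a' x'"
      by (metis F_def)
  qed
qed

end

section \<open>The infimum equals the least objective value\<close>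

theorem theorem4p2:
  fixes k :: nat and m n :: "nat \<Rightarrow> nat"
    and A :: "nat \<Rightarrow> complex mat" and B :: "nat \<Rightarrow> nat \<Rightarrow> complex mat"
  assumes "1 \<le> k"
    and "\<And>i. i \<in> {1..k} \<Longrightarrow> 1 \<le> n i \<and> n i \<le> m i"
    and "\<And>i. i \<in> {1..k} \<Longrightarrow> A i \<in> carrier_mat (m i) (n i)"
    and "\<And>i s. i \<in> {1..k} \<Longrightarrow> s \<in> {1..k} \<Longrightarrow> B i s \<in> carrier_mat (m i) (n i)"
  shows "(\<exists>g a x. sphere_params k g a \<and> unit_family k n x \<and>
            theta1 k m n A B = homog_objective k m A B g a x) \<and>
         (\<forall>g a x. sphere_params k g a \<and> unit_family k n x \<longrightarrow>
            theta1 k m n A B \<le> homog_objective k m A B g a x)"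
proof
  have le: "theta1 k m n A B \<le> homog_objective k m A B g a x"
    if "sphere_params k g a" "unit_family k n x" for g a x
    using theta1_le_homog_objective[of k A m n B g a x] assms(3,4) that by blast
  then show "\<forall>g a x. sphere_params k g a \<and> unit_family k n x \<longrightarrow>
      theta1 k m n A B \<le> homog_objective k m A B g a x"
    by blast
  obtain g a x where min: "sphere_params k g a" "unit_family k n x"
    and least: "\<And>g' a' x'. sphere_params k g' a' \<Longrightarrow> unit_family k n x' \<Longrightarrow>
      homog_objective k m A B g a x \<le> homog_objective k m A B g' a' x'"
    using homog_objective_attains_min[of k A m n B] assms by blast
  \<comment> \<open>Parameters with \<open>g = 1\<close> supply a member of
    \<open>mep_costs\<close>, so its infimum is taken over a nonempty set and can be bounded from
    below.\<close>
  have "sphere_params k 1 (\<lambda>_. 0)" by (simp add: sphere_params_def)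
  then have "homog_objective k m A B 1 (\<lambda>_. 0) x \<in> mep_costs k m n A B"
    using homog_objective_in_mep_costs[of k A m n B] assms(3,4) min(2) by simp
  then have "homog_objective k m A B g a x \<le> theta1 k m n A B"
    unfolding theta1_eq_Inf_mep_costs
  proof (intro cInf_greatest)
    \<comment> \<open>Each cost dominates some objective value, hence also the least one.\<close>
    fix c assume "c \<in> mep_costs k m n A B"
    then obtain g' a' x' where "sphere_params k g' a'" "unit_family k n x'"
      "homog_objective k m A B g' a' x' \<le> c"
      using mep_cost_ge_homog_objective[of k A m n B c] assms(3,4) by blast
    with least show "homog_objective k m A B g a x \<le> c" by (meson order_trans)
  qed blast
  with le[OF min] have "theta1 k m n A B = homog_objective k m A B g a x" by simp
  with min show "\<exists>g a x. sphere_params k g a \<and> unit_family k n x \<and>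
      theta1 k m n A B = homog_objective k m A B g a x"
    by blast
qed

end
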